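(* Let $G$ be a finite reflexive graph. Then $G$ is a strong cocomparability graph if and only if $G$ does not contain a weak edge-asteroid.
   Context: All graphs are finite and simple apart from loops. A graph is reflexive if every vertex carries a loop; its edge set $E(G)$ contains all loops $vv$, and an "edge" $uu'$ may be a loop ($u=u'$). A walk $u_0u_1\dots u_t$ ($t\ge 1$) in $G$ is a sequence of vertices with $u_ju_{j+1}\in E(G)$ for all $j$ (consecutive vertices may coincide, since loops are edges); its edges are $u_ju_{j+1}$, $0\le j<t$. The Slash matrix is the $2\times 2$ matrix with rows $(0,1)$ and $(1,0)$. A matrix contains the Slash matrix as a submatrix if there are rows $i<j$ and columns $k<l$ with entries $(i,k)=0$, $(i,l)=1$, $(j,k)=1$, $(j,l)=0$. A symmetric ordering of a square matrix is obtained by applying the same permutation to rows and columns. A reflexive graph is a strong cocomparability graph if its adjacency matrix (with 1's on the diagonal) has a symmetric ordering not containing the Slash matrix as a submatrix. For edges $uu'$, $vv'$ of a reflexive graph $G$ with $\{u,u'\}\cap\{v,v'\}=\emptyset$, $uu'$ avoids $vv'$ if one of the following holds: (i) $u=u'$, $v=v'$, $uv\notin E(G)$; (ii) $u=u'$, $v\ne v'$, $uv\notin E(G)$ and $uv'\notin E(G)$; (iii) $u\ne u'$, $v=v'$, $uv\notin E(G)$ and $u'v\notin E(G)$; (iv) $u\ne u'$, $v\ne v'$, and $\{u,u',v,v'\}$ induces a $2K_2$, a $P_4$, or a $C_4$ in $G$. (Equivalently: the two edges are vertex-disjoint, each of $u,u'$ has a non-neighbour in $\{v,v'\}$ and each of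 $v,v'$ has a non-neighbour in $\{u,u'\}$.) An edge avoids a walk if it avoids every edge of the walk. A weak edge-asteroid in $G$ is a set of edges $x_0y_0,x_1y_1,\dots,x_{2k}y_{2k}$ ($k\ge 1$) such that for each $i=0,\dots,2k$, the edge $x_iy_i$ avoids some walk whose first edge is $x_{i+k}y_{i+k}$ and whose last edge is $x_{i+k+1}y_{i+k+1}$ (subscripts modulo $2k+1$). *)

theory Defs
  imports Main
begin

definition reflexive_graph :: "'a set \<Rightarrow> ('a \<Rightarrow> 'a \<Rightarrow> bool) \<Rightarrow> bool" where
  "reflexive_graph V E \<longleftrightarrow> finite V
     \<and> (\<forall>u v. E u v \<longrightarrow> u \<in> V \<and> v \<in> V)
     \<and> (\<forall>u v. E u v \<longrightarrow> E v u)
     \<and> (\<forall>v\<in>V. E v v)"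

text \<open>Adjacency matrix in the symmetric ordering given by the enumeration vs of V:
entry (i,j) is 1 iff E (vs!i) (vs!j). Slash submatrix: rows i<j, columns k<l with
entries 0 1 / 1 0.\<close>

definition contains_slash :: "('a \<Rightarrow> 'a \<Rightarrow> bool) \<Rightarrow> 'a list \<Rightarrow> bool" where
  "contains_slash E vs \<longleftrightarrow> (\<exists>i j k l. i < j \<and> j < length vs \<and> k < l \<and> l < length vs
     \<and> \<not> E (vs!i) (vs!k) \<and> E (vs!i) (vs!l) \<and> E (vs!j) (vs!k) \<and> \<not> E (vs!j) (vs!l))"

definition strong_cocomparability :: "'a set \<Rightarrow> ('a \<Rightarrow> 'a \<Rightarrow> bool) \<Rightarrow> bool" where
  "strong_cocomparability V E \<longleftrightarrow>
     (\<exists>vs. distinct vs \<and> set vs = V \<and> \<not> contains_slash E vs)"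

text \<open>Edge uu' avoids edge vv', following cases (i)-(iv). In case (iv) the four
vertices are distinct and uu', vv' are edges; the induced subgraph is 2K2, P4 or C4
iff the set of "cross" edges between {u,u'} and {v,v'} is empty (2K2), a single
pair (P4), or one of the two perfect matchings (C4).\<close>

definition avoids :: "('a \<Rightarrow> 'a \<Rightarrow> bool) \<Rightarrow> 'a \<times> 'a \<Rightarrow> 'a \<times> 'a \<Rightarrow> bool" where
  "avoids E e f \<longleftrightarrow> (case e of (u, u') \<Rightarrow> case f of (v, v') \<Rightarrow>
     {u, u'} \<inter> {v, v'} = {} \<and>
     ((u = u' \<and> v = v' \<and> \<not> E u v)
      \<or> (u = u' \<and> v \<noteq> v' \<and> \<not> E u v \<and> \<not> E u v')
      \<or> (u \<noteq> u' \<and> v = v' \<and> \<not> E u v \<and> \<not> E u' v)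
      \<or> (u \<noteq> u' \<and> v \<noteq> v' \<and>
          (let C = {p \<in> {(u, v), (u, v'), (u', v), (u', v')}. E (fst p) (snd p)} in
             C = {} \<or> card C = 1 \<or> C = {(u, v), (u', v')} \<or> C = {(u, v'), (u', v)}))))"

definition is_walk :: "('a \<Rightarrow> 'a \<Rightarrow> bool) \<Rightarrow> 'a list \<Rightarrow> bool" where
  "is_walk E w \<longleftrightarrow> length w \<ge> 2 \<and> (\<forall>j. j + 1 < length w \<longrightarrow> E (w!j) (w!(j+1)))"

definition avoids_walk :: "('a \<Rightarrow> 'a \<Rightarrow> bool) \<Rightarrow> 'a \<times> 'a \<Rightarrow> 'a list \<Rightarrow> bool" where
  "avoids_walk E e w \<longleftrightarrow> (\<forall>j. j + 1 < length w \<longrightarrow> avoids E e (w!j, w!(j+1)))"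

text \<open>Edges are unordered: "first edge of the walk is xy" means {w0,w1} = {x,y}.\<close>

definition weak_edge_asteroid ::
  "('a \<Rightarrow> 'a \<Rightarrow> bool) \<Rightarrow> nat \<Rightarrow> (nat \<Rightarrow> 'a) \<Rightarrow> (nat \<Rightarrow> 'a) \<Rightarrow> bool" where
  "weak_edge_asteroid E k x y \<longleftrightarrow> k \<ge> 1
     \<and> (\<forall>i \<le> 2*k. E (x i) (y i))
     \<and> (\<forall>i \<le> 2*k. \<exists>w. is_walk E w
          \<and> {w!0, w!1} = {x ((i+k) mod (2*k+1)), y ((i+k) mod (2*k+1))}
          \<and> {w!(length w - 2), w!(length w - 1)}
              = {x ((i+k+1) mod (2*k+1)), y ((i+k+1) mod (2*k+1))}
          \<and> avoids_walk E (x i, y i) w)"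

definition has_weak_edge_asteroid :: "('a \<Rightarrow> 'a \<Rightarrow> bool) \<Rightarrow> bool" where
  "has_weak_edge_asteroid E \<longleftrightarrow> (\<exists>k x y. weak_edge_asteroid E k x y)"

end

theory Submission
  imports Defs
begin

text \<open>
Slash-freeness says that a symmetric ordering respects a forcing relation between ordered pairs of
vertices: \<open>(a, b)\<close> and \<open>(c, d)\<close> are ordered alike whenever \<open>ac\<close>, \<open>bd\<close> are edges and \<open>ad\<close>, \<open>bc\<close> are
not. In a slash-free ordering, if an edge avoids a walk then all edges of the walk have their left
ends on the same side of its own left end; around an asteroid this is contradictory because the
period is odd. Conversely, a forcing chain from \<open>(a, b)\<close> to \<open>(b, a)\<close> closes up to a cyclic walk that
contains an asteroid.

If no chain reverses a pair, every forcing class (up to reversal) can be oriented independently and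
it remains to avoid cyclic triangles, since an orientation without them is transitive. Classes are
oriented lexicographically: a class is represented by its pair with the least first vertex, and that
vertex is made a source. Rows and columns share one ordering, so this fails for those pairs
\<open>(p, q)\<close> from which an odd chain leads to some \<open>(q', p)\<close>; such bad pairs are used as
representatives only as a last resort. A forcing step applied to one side of a cyclic triangle
yields another cyclic triangle whose apex alternates between two fixed vertices along the
whole chain. Applied to the cyclic triangle whose side has the least representative, this gives a
contradiction.
\<close>

section \<open>Forcing chains\<close>

locale refl_graph =
  fixes V :: "'a set" and E :: "'a \<Rightarrow> 'a \<Rightarrow> bool"
  assumes refl_graph: "reflexive_graph V E"
begin

lemma finite_V: "finite V"
  and E_in_V: "E u v \<Longrightarrow> u \<in> V \<and> v \<in> V"
  and E_sym: "E u v \<Longrightarrow> E v u"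
  and E_refl: "v \<in> V \<Longrightarrow> E v v"
  using refl_graph unfolding reflexive_graph_def by blast+

lemma E_commute: "E u v = E v u"
  using E_sym by blast

definition cross :: "'a \<Rightarrow> 'a \<Rightarrow> 'a \<Rightarrow> 'a \<Rightarrow> bool" where
  "cross a b c d \<longleftrightarrow> E a c \<and> E b d \<and> \<not> E a d \<and> \<not> E b c"

lemma cross_sym: "cross a b c d \<Longrightarrow> cross c d a b"
  unfolding cross_def using E_sym by blast

lemma cross_swap: "cross a b c d \<Longrightarrow> cross b a d c"
  unfolding cross_def by blast

text \<open>The flag records the parity of the number of steps; \<^const>\<open>True\<close> means odd.\<close>

inductive linked :: "bool \<Rightarrow> 'a \<Rightarrow> 'a \<Rightarrow> 'a \<Rightarrow> 'a \<Rightarrow> bool" where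
  refl: "linked False a b a b"
| step: "linked par a b c d \<Longrightarrow> cross c d e f \<Longrightarrow> linked (\<not> par) a b e f"

lemma linked_cross: "cross a b c d \<Longrightarrow> linked True a b c d"
  using linked.step[OF linked.refl] by simp

lemma linked_trans:
  assumes "linked par' c d e f" and "linked par a b c d"
  shows "linked (par \<noteq> par') a b e f"
  using assms
proof (induction rule: linked.induct)
  case (refl c d)
  then show ?case by simp
next
  case (step par' c d e f g h)
  then have "linked (\<not> (par \<noteq> par')) a b g h"
    using linked.step by blast
  then show ?case by (cases par) simp_all
qed

lemma linked_sym: "linked par a b c d \<Longrightarrow> linked par c d a b"
proof (induction rule: linked.induct)
  case (refl a b)
  show ?case by (rule linked.refl)
next
  case (step par a b c d e f)
  then have "linked (True \<noteq> par) e f a b"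
    using linked_trans linked_cross cross_sym by blast
  then show ?case by simp
qed

lemma linked_swap: "linked par a b c d \<Longrightarrow> linked par b a d c"
  by (induction rule: linked.induct) (auto intro: linked.intros cross_swap)

definition equi :: "'a \<Rightarrow> 'a \<Rightarrow> 'a \<Rightarrow> 'a \<Rightarrow> bool" where
  "equi a b c d \<longleftrightarrow> (\<exists>par. linked par a b c d)"

lemma equi_refl: "equi a b a b"
  unfolding equi_def using linked.refl by blast

lemma equi_sym: "equi a b c d \<Longrightarrow> equi c d a b"
  unfolding equi_def using linked_sym by blast

lemma equi_trans: "equi a b c d \<Longrightarrow> equi c d e f \<Longrightarrow> equi a b e f"
  unfolding equi_def using linked_trans by blast

lemma equi_swap: "equi a b c d \<Longrightarrow> equi b a d c"
  unfolding equi_def using linked_swap by blast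

lemma equi_cross: "cross a b c d \<Longrightarrow> equi a b c d"
  unfolding equi_def using linked_cross by blast

text \<open>Equivalently, the neighbourhoods of \<open>a\<close> and \<open>b\<close> are
  incomparable under inclusion.\<close>

definition incomp :: "'a \<Rightarrow> 'a \<Rightarrow> bool" where
  "incomp a b \<longleftrightarrow> (\<exists>c d. cross a b c d)"

lemma incomp_sym: "incomp a b \<Longrightarrow> incomp b a"
  unfolding incomp_def using cross_swap by blast

lemma incomp_cross: "cross a b c d \<Longrightarrow> incomp c d"
  unfolding incomp_def using cross_sym by blast

lemma incomp_linked: "linked par a b c d \<Longrightarrow> incomp a b \<Longrightarrow> incomp c d"
  by (induction rule: linked.induct) (auto intro: incomp_cross)

text \<open>Orienting \<open>p\<close> before \<open>q\<close> then also orients \<open>q'\<close>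
  before \<open>p\<close>, so \<open>p\<close> cannot be a source. Only odd chains count: even ones
  keep the apex of a cyclic triangle and are handled by \<open>apex_even\<close>.\<close>

definition bad :: "'a \<Rightarrow> 'a \<Rightarrow> bool" where
  "bad p q \<longleftrightarrow> (\<exists>q'. linked True p q q' p)"

end

section \<open>Cyclic triangles\<close>

locale orientation = refl_graph +
  fixes D :: "'a \<Rightarrow> 'a \<Rightarrow> bool"
  assumes D_cross: "D a b \<Longrightarrow> cross a b c d \<Longrightarrow> D c d"
    and D_asym: "D a b \<Longrightarrow> \<not> D b a"
    and D_total: "incomp a b \<Longrightarrow> D a b \<or> D b a"
    and D_incomp: "D a b \<Longrightarrow> incomp a b"
begin

definition cyc :: "'a \<Rightarrow> 'a \<Rightarrow> 'a \<Rightarrow> bool" where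
  "cyc a b c \<longleftrightarrow> D a b \<and> D b c \<and> D c a"

lemma cyc_rotate: "cyc a b c \<Longrightarrow> cyc b c a"
  unfolding cyc_def by blast

text \<open>The adjacency matrix with rows \<open>a, b, c\<close> and columns \<open>x, b', c'\<close> is the identity matrix for
\<open>diag\<close>; for \<open>codiag\<close> it is the complement of a permutation matrix, with zeros at \<open>ax\<close>, \<open>bc'\<close>
and \<open>cb'\<close>.\<close>

definition diag :: "'a \<Rightarrow> 'a \<Rightarrow> 'a \<Rightarrow> 'a \<Rightarrow> 'a \<Rightarrow> 'a \<Rightarrow> bool" where
  "diag a b c x b' c' \<longleftrightarrow> cyc a b c \<and> cross b c b' c'
     \<and> E a x \<and> \<not> E a b' \<and> \<not> E a c' \<and> \<not> E b x \<and> \<not> E c x"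

definition codiag :: "'a \<Rightarrow> 'a \<Rightarrow> 'a \<Rightarrow> 'a \<Rightarrow> 'a \<Rightarrow> 'a \<Rightarrow> bool" where
  "codiag a b c x b' c' \<longleftrightarrow> cyc a b c \<and> cross b c b' c'
     \<and> \<not> E a x \<and> E a b' \<and> E a c' \<and> E b x \<and> E c x"

text \<open>If \<open>a\<close> saw exactly one of \<open>b'\<close>, \<open>c'\<close>, it could
  replace \<open>b\<close> or \<open>c\<close> in the forcing step, and \<open>(b', c')\<close>
  would force a side of the triangle in the wrong direction.\<close>

lemma apex_same:
  assumes "cyc a b c" "cross b c b' c'"
  shows "E a b' = E a c'"
proof (rule ccontr)
  assume "E a b' \<noteq> E a c'"
  then consider "E a b'" "\<not> E a c'" | "\<not> E a b'" "E a c'" by blast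
  then show False
  proof cases
    case 1
    then have "cross a c b' c'" using assms unfolding cross_def by blast
    then show False using assms D_cross cross_sym D_asym unfolding cyc_def by metis
  next
    case 2
    then have "cross b a b' c'" using assms unfolding cross_def by blast
    then show False using assms D_cross cross_sym D_asym unfolding cyc_def by metis
  qed
qed

text \<open>A witness \<open>x\<close>, \<open>y\<close> for the incomparability of \<open>a\<close>
  and \<open>b\<close> supplies the missing column: \<open>y\<close> if \<open>a\<close> sees both
  \<open>b'\<close> and \<open>c'\<close>, \<open>x\<close> if it sees neither. The wrong adjacency
  to \<open>c\<close> would force \<open>D b a\<close>.\<close>

lemma diag_or_codiag_exists:
  assumes cyc: "cyc a b c" and cr: "cross b c b' c'"
  shows "(\<exists>x. diag a b c x b' c') \<or> (\<exists>x. codiag a b c x b' c')"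
proof -
  have "incomp a b" using cyc D_incomp unfolding cyc_def by blast
  then obtain x y where xy: "cross a b x y" unfolding incomp_def by blast
  show ?thesis
  proof (cases "E a b'")
    case True
    then have ac: "E a c'" using apex_same[OF cyc cr] by blast
    have "E c y"
    proof (rule ccontr)
      assume "\<not> E c y"
      then have "cross b c y c'" "cross b a y c'"
        using xy cr ac unfolding cross_def by blast+
      then show False using cyc D_cross cross_sym D_asym unfolding cyc_def by metis
    qed
    then have "codiag a b c y b' c'"
      using xy cr cyc ac True unfolding codiag_def cross_def by blast
    then show ?thesis by blast
  next
    case False
    then have ac: "\<not> E a c'" using apex_same[OF cyc cr] by blast
    have "\<not> E c x"
    proof
      assume "E c x"
      then have "cross b c b' x" "cross b a b' x"
        using xy cr False unfolding cross_def by blast+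
      then show False using cyc D_cross cross_sym D_asym unfolding cyc_def by metis
    qed
    then have "diag a b c x b' c'"
      using xy cr cyc ac False unfolding diag_def cross_def by blast
    then show ?thesis by blast
  qed
qed

text \<open>Each side of \<open>a b c\<close> forces the corresponding side of
  \<open>x b' c'\<close>, so the columns form a cyclic triangle too and the matrix may be
  transposed.\<close>

lemma diag_sym:
  assumes "diag a b c x b' c'"
  shows "diag x b' c' a b c"
proof -
  have "cross a b x b'" "cross b c b' c'" "cross c a c' x"
    using assms unfolding diag_def cross_def by blast+
  then have "cyc x b' c'"
    using assms D_cross unfolding diag_def cyc_def by blast
  then show ?thesis
    using assms cross_sym E_commute unfolding diag_def by blast
qed

text \<open>Unlike in \<open>diag\<close>, a side with \<open>a\<close> in first position forces a
  side with \<open>x\<close> in second position.\<close>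

lemma codiag_cross:
  assumes "codiag a b c x b' c'"
  shows "cross a b c' x" "cross a c b' x"
  using assms unfolding codiag_def cross_def by blast+

lemma codiag_sym:
  assumes "codiag a b c x b' c'"
  shows "codiag x b' c' a b c"
proof -
  have "cyc x b' c'"
    using assms D_cross codiag_cross[OF assms] cross_swap unfolding codiag_def cyc_def by blast
  then show ?thesis
    using assms cross_sym E_commute unfolding codiag_def by blast
qed

text \<open>Otherwise one vertex from each of the two forced pairs makes a mixed pair, forced by
  \<open>(b', c')\<close>, that in turn forces \<open>D b' x\<close> against
  \<open>D x b'\<close>.\<close>

lemma apex_no_switch:
  assumes "cyc x b' c'" "cross b' c' b c" "cross b' c' b'' c''"
  shows "E x b = E x b''"
proof (rule ccontr)
  assume neq: "E x b \<noteq> E x b''"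
  have same: "E x b = E x c" "E x b'' = E x c''"
    using assms apex_same by blast+
  consider "\<not> E x b" "E x c''" | "\<not> E x b''" "E x c" using neq same by blast
  then show False
  proof cases
    case 1
    then have "cross b' x b c''" "cross b' c' b c''"
      using assms unfolding cross_def by blast+
    then show False using assms D_cross cross_sym D_asym unfolding cyc_def by metis
  next
    case 2
    then have "cross b' x b'' c" "cross b' c' b'' c"
      using assms unfolding cross_def by blast+
    then show False using assms D_cross cross_sym D_asym unfolding cyc_def by metis
  qed
qed

lemma diag_step:
  assumes "diag a b c x b' c'" "cross b c u v"
  shows "diag a b c x u v"
  using assms apex_no_switch[of a b c b' c' u v] apex_same[of a b c u v]
  unfolding diag_def by simp

lemma codiag_step:
  assumes "codiag a b c x b' c'" "cross b c u v"
  shows "codiag a b c x u v"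
  using assms apex_no_switch[of a b c b' c' u v] apex_same[of a b c u v]
  unfolding codiag_def by simp

section \<open>Transport of cyclic triangles along forcing chains\<close>

text \<open>The next pair of the chain can always serve as the opposite side, and
  \<open>diag_sym\<close> then exchanges the two triangles. So the apex alternates between
  \<open>a\<close> and \<open>x\<close>.\<close>

lemma diag_linked:
  assumes "linked par b c u v" "diag a b c x b' c'"
  shows "if par then \<exists>w z. diag x u v a w z else \<exists>w z. diag a u v x w z"
  using assms
proof (induction rule: linked.induct)
  case (refl b c)
  then show ?case by auto
next
  case (step par b c u v u' v')
  show ?case
  proof (cases par)
    case True
    then have "\<exists>w z. diag x u v a w z" using step by simp
    then have "diag x u v a u' v'" using diag_step step.hyps(2) by blast
    then have "diag a u' v' x u v" by (rule diag_sym)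
    then show ?thesis using True by auto
  next
    case False
    then have "\<exists>w z. diag a u v x w z" using step by simp
    then have "diag a u v x u' v'" using diag_step step.hyps(2) by blast
    then have "diag x u' v' a u v" by (rule diag_sym)
    then show ?thesis using False by auto
  qed
qed

text \<open>The argument of \<open>diag_linked\<close>, with the sides at the apex carried along as
  well by \<open>codiag_cross\<close>. These extra chains are what the lemmas on bad pairs
  use.\<close>

lemma codiag_linked:
  assumes "linked par b c u v" "codiag a b c x b' c'"
  shows "if par then (\<exists>w z. codiag x u v a w z) \<and> linked True a b v x \<and> linked True a c u x
    else (\<exists>w z. codiag a u v x w z) \<and> linked False a b a u \<and> linked False a c a v"
  using assms
proof (induction rule: linked.induct)
  case (refl b c)
  then show ?case by (auto intro: linked.refl)
next
  case (step par b c u v u' v')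
  show ?case
  proof (cases par)
    case True
    then have "\<exists>w z. codiag x u v a w z" and l: "linked True a b v x" "linked True a c u x"
      using step by simp_all
    then have "codiag x u v a u' v'"
      using codiag_step step.hyps(2) by blast
    moreover have "cross v x a u'" "cross u x a v'"
      using codiag_cross[OF calculation] cross_swap by blast+
    then have "linked (\<not> True) a b a u'" "linked (\<not> True) a c a v'"
      using l linked.step by blast+
    moreover have "codiag a u' v' x u v"
      using \<open>codiag x u v a u' v'\<close> by (rule codiag_sym)
    ultimately show ?thesis using True by auto
  next
    case False
    then have "\<exists>w z. codiag a u v x w z" and l: "linked False a b a u" "linked False a c a v"
      using step by simp_all
    then have "codiag a u v x u' v'"
      using codiag_step step.hyps(2) by blast
    moreover have "cross a u v' x" "cross a v u' x"
      using codiag_cross[OF calculation] by blast+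
    then have "linked (\<not> False) a b v' x" "linked (\<not> False) a c u' x"
      using l linked.step by blast+
    moreover have "codiag x u' v' a u v"
      using \<open>codiag a u v x u' v'\<close> by (rule codiag_sym)
    ultimately show ?thesis using False by auto
  qed
qed

lemma apex_cases:
  assumes "cyc a b c"
  obtains (diag) x b' c' where "diag a b c x b' c'"
  | (codiag) x b' c' where "codiag a b c x b' c'"
proof -
  have "incomp b c" using assms D_incomp unfolding cyc_def by blast
  then obtain b' c' where "cross b c b' c'" unfolding incomp_def by blast
  then show ?thesis using diag_or_codiag_exists[OF assms] that by blast
qed

lemma apex_even:
  assumes "cyc a b c" "linked False b c u v"
  shows "cyc a u v"
  using assms(1)
proof (cases rule: apex_cases)
  case diag
  from diag_linked[OF assms(2) this] show ?thesis unfolding diag_def by auto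
next
  case codiag
  from codiag_linked[OF assms(2) this] show ?thesis unfolding codiag_def by auto
qed

lemma apex_equi:
  assumes "cyc a b c" "equi b c u v"
  shows "\<exists>x. cyc x u v"
proof -
  obtain par where l: "linked par b c u v" using assms unfolding equi_def by blast
  from assms(1) show ?thesis
  proof (cases rule: apex_cases)
    case diag
    from diag_linked[OF l this] show ?thesis unfolding diag_def by (cases par) auto
  next
    case codiag
    from codiag_linked[OF l this] show ?thesis unfolding codiag_def by (cases par) auto
  qed
qed

text \<open>After an odd chain the apex is \<open>x\<close>, and \<open>u\<close>, \<open>v\<close>
  are not adjacent to \<open>a\<close>. If \<open>u = c\<close> or \<open>v = b\<close>, the loop at
  this shared vertex yields a forcing step that contradicts the direction of a side.\<close>

lemma diag_not_odd:
  assumes dg: "diag a b c x b' c'" and l: "linked True b c u v"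
  shows "u \<noteq> c" and "v \<noteq> b"
proof -
  from diag_linked[OF l dg] obtain w z where "diag x u v a w z" by auto
  then have xuv: "cyc x u v" "\<not> E u a" "\<not> E v a" unfolding diag_def by auto
  have abc: "cyc a b c" "E a x" "\<not> E b x" "\<not> E c x" "E b b" "E c c"
    using dg E_in_V E_refl unfolding diag_def cross_def by blast+
  show "u \<noteq> c"
  proof
    assume [simp]: "u = c"
    have "cross a c x c" using xuv abc E_commute unfolding cross_def by auto
    then show False using xuv abc D_cross cross_sym D_asym unfolding cyc_def
      by (metis \<open>u = c\<close>)
  qed
  show "v \<noteq> b"
  proof
    assume [simp]: "v = b"
    have "cross a b x b" using xuv abc E_commute unfolding cross_def by auto
    then show False using xuv abc D_cross D_asym unfolding cyc_def
      by (metis \<open>v = b\<close>)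
  qed
qed

section \<open>Bad pairs in cyclic triangles\<close>

text \<open>The chain witnessing \<open>bad p a\<close> rules out \<open>diag\<close> over the side
  \<open>(a, p)\<close>. In the \<open>codiag\<close> case it carries \<open>(q, p)\<close> to
  \<open>(p, x)\<close>, which witnesses \<open>bad p q\<close>.\<close>

lemma bad_in_cyc:
  assumes "cyc p q a" "bad p a"
  shows "bad p q"
proof -
  obtain a' where "linked True p a a' p" using assms unfolding bad_def by blast
  then have l: "linked True a p p a'" by (rule linked_swap)
  have "cyc q a p" using assms(1) by (rule cyc_rotate)
  then show ?thesis
  proof (cases rule: apex_cases)
    case diag
    from diag_not_odd(1)[OF this l] show ?thesis by simp
  next
    case (codiag x b' c')
    from codiag_linked[OF l this] have "linked True q p p x" by simp
    then show ?thesis unfolding bad_def using linked_swap by blast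
  qed
qed

text \<open>The two odd chains carry \<open>(a, q)\<close> to \<open>(q', x)\<close> and to
  \<open>(q, x)\<close>. Their composition is an even chain, which turns \<open>cyc p x q'\<close>
  into \<open>cyc p x q\<close> and gives \<open>D q p\<close>.\<close>

lemma not_both_bad_in_cyc:
  assumes "cyc p q a" "bad p q" "bad q p"
  shows False
proof -
  obtain q' where l1: "linked True p q q' p" using assms unfolding bad_def by blast
  obtain p' where "linked True q p p' q" using assms unfolding bad_def by blast
  then have l2: "linked True p q q p'" by (rule linked_swap)
  have "cyc a p q" using assms(1) cyc_rotate by blast
  then show ?thesis
  proof (cases rule: apex_cases)
    case diag
    from diag_not_odd(2)[OF this l1] show ?thesis by simp
  next
    case (codiag x b' c')
    from codiag_linked[OF l1 this] have 1: "linked True a q q' x" and "\<exists>w z. codiag x q' p a w z"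
      by auto
    then have "cyc p x q'" unfolding codiag_def cyc_def by blast
    moreover from codiag_linked[OF l2 codiag] have "linked True a q q x" by simp
    then have "linked (True \<noteq> True) q' x q x" using 1 linked_trans linked_sym by blast
    then have "linked False x q' x q" using linked_swap by simp
    ultimately have "cyc p x q" by (rule apex_even)
    then show False using assms(1) D_asym unfolding cyc_def by blast
  qed
qed

text \<open>If the neighbourhoods of \<open>a\<close> and \<open>c\<close> were nested, a common
  pair of columns would force \<open>(a, b)\<close> and \<open>(c, b)\<close> alike, against
  \<open>D a b\<close> and \<open>D b c\<close>. So \<open>a\<close> and \<open>c\<close> are
  oriented, and \<open>D c a\<close> would close a cyclic triangle.\<close>

lemma D_trans:
  assumes acyclic: "\<And>a b c. \<not> cyc a b c" and ab: "D a b" and bc: "D b c"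
  shows "D a c"
proof -
  obtain x y where xy: "cross a b x y" using D_incomp[OF ab] unfolding incomp_def by blast
  obtain w z where wz: "cross b c w z" using D_incomp[OF bc] unfolding incomp_def by blast
  have "incomp a c"
  proof (rule ccontr)
    assume "\<not> incomp a c"
    then consider "\<And>v. E a v \<Longrightarrow> E c v" | "\<And>v. E c v \<Longrightarrow> E a v"
      unfolding incomp_def cross_def by blast
    then show False
    proof cases
      case 1
      then have "cross a b x w" "cross c b x w"
        using xy wz unfolding cross_def by blast+
      then show False using ab bc D_cross cross_sym D_asym by blast
    next
      case 2
      then have "cross a b z y" "cross c b z y"
        using xy wz unfolding cross_def by blast+
      then show False using ab bc D_cross cross_sym D_asym by blast
    qed
  qed
  then show ?thesis using D_total acyclic ab bc unfolding cyc_def by blast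
qed

end

section \<open>Existence of a slash-free ordering\<close>

lemma finite_linear_extension:
  fixes R :: "'a \<Rightarrow> 'a \<Rightarrow> bool"
  assumes "finite A" "asymp R" "transp R"
  shows "\<exists>xs. distinct xs \<and> set xs = A \<and> sorted_wrt (\<lambda>x y. \<not> R y x) xs"
  using \<open>finite A\<close>
proof (induction rule: finite_psubset_induct)
  case (psubset A)
  show ?case
  proof (cases "A = {}")
    case True
    then show ?thesis by (intro exI[of _ "[]"]) simp
  next
    case False
    have "asymp_on A R" "transp_on A R"
      using assms(2,3) asymp_on_subset transp_on_subset by blast+
    then obtain m where m: "m \<in> A" "\<forall>x\<in>A. x \<noteq> m \<longrightarrow> \<not> R x m"
      using Finite_Set.bex_min_element[OF psubset.hyps] False by blast
    obtain xs where "distinct xs" "set xs = A - {m}" "sorted_wrt (\<lambda>x y. \<not> R y x) xs"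
      using psubset.IH[of "A - {m}"] m by blast
    then show ?thesis using m by (intro exI[of _ "m # xs"]) auto
  qed
qed

context refl_graph
begin

lemma incomp_in_V: "incomp a b \<Longrightarrow> a \<in> V \<and> b \<in> V"
  unfolding incomp_def cross_def using E_in_V by blast

lemma incomp_equi: "equi a b c d \<Longrightarrow> incomp a b \<Longrightarrow> incomp c d"
  unfolding equi_def using incomp_linked by blast

lemma acyclic_orientation_exists:
  assumes no_inversion: "\<And>a b. incomp a b \<Longrightarrow> \<not> equi a b b a"
  obtains D where "orientation V E D" "\<And>a b c. D a b \<Longrightarrow> D b c \<Longrightarrow> \<not> D c a"
proof -
  obtain f :: "'a \<Rightarrow> nat" and n where f: "f ` V = {i. i < n}" "inj_on f V"
    using finite_imp_inj_to_nat_seg[OF finite_V] by blast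
  \<comment> \<open>The value \<open>n\<close> exceeds every \<open>f p\<close>, so a bad pair
    represents a class only if all its pairs, in both directions, are bad.\<close>
  define weight where "weight = (\<lambda>(p, q). if bad p q then n else f p)"
  define K where "K a b = (\<lambda>(p, q). equi a b p q \<or> equi b a p q)" for a b
  define rep where "rep a b = arg_min weight (K a b)" for a b
  define D where "D a b \<longleftrightarrow> incomp a b \<and> equi a b (fst (rep a b)) (snd (rep a b))" for a b

  have f_less: "f v < n" if "v \<in> V" for v
    using that f by blast
  have "K a b (a, b)" for a b
    unfolding K_def by (simp add: equi_refl)
  then have rep_in: "K a b (rep a b)"
    and rep_le: "K a b z \<Longrightarrow> weight (rep a b) \<le> weight z" for a b z
    using arg_min_nat_lemma[of "K a b" "(a, b)" weight] unfolding rep_def by blast+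
  have K_swap: "K b a = K a b" for a b
    unfolding K_def by (intro ext) auto
  have K_equi: "K a b = K c d" if "equi a b c d" for a b c d
  proof -
    have "equi a b p q = equi c d p q" "equi b a p q = equi d c p q" for p q
      using that equi_sym equi_trans equi_swap by meson+
    then show ?thesis unfolding K_def by simp
  qed
  have D_equi: "D c d" if "D a b" "equi a b c d" for a b c d
  proof -
    have "rep a b = rep c d" using K_equi[OF that(2)] unfolding rep_def by simp
    then show ?thesis
      using that incomp_equi equi_sym equi_trans unfolding D_def by metis
  qed
  have "orientation V E D"
  proof
    show "D c d" if "D a b" "cross a b c d" for a b c d
      using that D_equi equi_cross by blast
    show "\<not> D b a" if "D a b" for a b
    proof -
      have "rep b a = rep a b" using K_swap unfolding rep_def by simp
      then show ?thesis
        using that no_inversion equi_sym equi_trans unfolding D_def by metis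
    qed
    show "D a b \<or> D b a" if "incomp a b" for a b
    proof -
      have "rep b a = rep a b" using K_swap unfolding rep_def by simp
      then show ?thesis
        using that rep_in[of a b] incomp_sym unfolding D_def K_def by (auto split: prod.splits)
    qed
    show "incomp a b" if "D a b" for a b
      using that unfolding D_def by blast
  qed
  then interpret orientation V E D .

  have "\<not> cyc a b c" for a b c
  proof
    assume "cyc a b c"
    \<comment> \<open>Only the first side is weighed; by rotation the minimum still ranges over all
      sides of all cyclic triangles.\<close>
    define m where "m = (\<lambda>(a, b, c :: 'a). weight (rep a b))"
    obtain t where t: "(\<lambda>(a, b, c). cyc a b c) t"
      and t_min: "\<And>s. (\<lambda>(a, b, c). cyc a b c) s \<Longrightarrow> m t \<le> m s"
      using ex_has_least_nat[of "\<lambda>(a, b, c). cyc a b c" "(a, b, c)" m] \<open>cyc a b c\<close> by auto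
    obtain a0 b0 c0 where t_eq: "t = (a0, b0, c0)" by (cases t)
    obtain p q where pq: "rep a0 b0 = (p, q)" by fastforce
    have "D a0 b0" using t t_eq unfolding cyc_def by simp
    then have "equi a0 b0 p q" using pq unfolding D_def by simp
    moreover have "cyc c0 a0 b0" using t t_eq cyc_rotate by simp
    \<comment> \<open>The minimal triangle is moved so that the representative \<open>(p, q)\<close>
      is itself a side.\<close>
    ultimately obtain r where "cyc r p q" using apex_equi by blast
    then have pqr: "cyc p q r" by (rule cyc_rotate)
    have min: "weight (p, q) \<le> weight (rep u v)" if "cyc u v w" for u v w
      using t_min[of "(u, v, w)"] that t_eq pq unfolding m_def by simp
    have V: "p \<in> V" "q \<in> V" "r \<in> V"
      using pqr D_incomp incomp_in_V unfolding cyc_def by blast+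
    show False
    proof (cases "bad p q")
      case True
      \<comment> \<open>If the minimum is bad, the whole class is, including the reversed pair
        \<open>(q, p)\<close>.\<close>
      have "n \<le> weight (rep p q)" using min[OF pqr] True unfolding weight_def by simp
      also have "\<dots> \<le> weight (q, p)"
        by (rule rep_le) (simp add: K_def equi_refl)
      finally have "bad q p"
        using f_less[OF V(2)] unfolding weight_def by (simp split: if_splits)
      then show False using not_both_bad_in_cyc pqr True by blast
    next
      case False
      then have good: "\<not> bad p r" using bad_in_cyc pqr by blast
      have rpq: "cyc r p q" and qrp: "cyc q r p" using pqr cyc_rotate by blast+
      obtain u v where uv: "rep r p = (u, v)" by fastforce
      have "D r p" using pqr unfolding cyc_def by blast
      then have eq: "equi r p u v" using uv unfolding D_def by simp
      \<comment> \<open>The good pair \<open>(p, r)\<close> competes for the representative of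
        \<open>(r, p)\<close>. With minimality of \<open>(p, q)\<close> this pins the weight to
        \<open>f p\<close>, hence \<open>u = p\<close>.\<close>
      have "weight (u, v) \<le> weight (p, r)"
        unfolding uv[symmetric] by (rule rep_le) (simp add: K_def equi_refl)
      then have le: "weight (u, v) \<le> f p" using good unfolding weight_def by simp
      then have good_uv: "\<not> bad u v"
        using f_less[OF V(1)] unfolding weight_def by (auto split: if_splits)
      have "f p \<le> f u" using min[OF rpq] uv False good_uv unfolding weight_def by simp
      moreover have "f u \<le> f p" using le good_uv unfolding weight_def by simp
      moreover have "u \<in> V"
        using eq \<open>D r p\<close> D_incomp incomp_equi incomp_in_V by blast
      ultimately have "u = p" using f V by (metis inj_onD le_antisym)
      then obtain par where l: "linked par r p p v" using eq unfolding equi_def by blast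
      show False
      \<comment> \<open>An odd chain from \<open>(r, p)\<close> to \<open>(p, v)\<close> would make
        the representative bad; an even one keeps the apex \<open>q\<close> and gives
        \<open>D q p\<close>.\<close>
      proof (cases par)
        case True
        then have "linked True p v r p" using l linked_sym by simp
        then have "bad p v" unfolding bad_def by blast
        then show False using good_uv \<open>u = p\<close> by blast
      next
        case False
        then have "cyc q p v" using apex_even qrp l by simp
        then show False using pqr D_asym unfolding cyc_def by blast
      qed
    qed
  qed
  then show ?thesis using that \<open>orientation V E D\<close> unfolding cyc_def by blast
qed

lemma strong_cocomparability_if_no_inversion:
  assumes "\<And>a b. incomp a b \<Longrightarrow> \<not> equi a b b a"
  shows "strong_cocomparability V E"
proof -
  obtain D where "orientation V E D" and acyclic: "\<And>a b c. D a b \<Longrightarrow> D b c \<Longrightarrow> \<not> D c a"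
    using acyclic_orientation_exists assms by blast
  then interpret orientation V E D by simp
  have no_cyc: "\<not> cyc a b c" for a b c using acyclic unfolding cyc_def by blast
  have "transp D" by (rule transpI) (rule D_trans[OF no_cyc])
  moreover have "asymp D" using D_asym by (intro asympI)
  ultimately obtain vs where vs: "distinct vs" "set vs = V" "sorted_wrt (\<lambda>x y. \<not> D y x) vs"
    using finite_linear_extension finite_V by blast
  have "\<not> contains_slash E vs"
  proof
    assume "contains_slash E vs"
    \<comment> \<open>A slash is a forcing step with its two columns in reversed order.\<close>
    then obtain i j k l where ij: "i < j" "j < length vs" and kl: "k < l" "l < length vs"
      and "cross (vs ! i) (vs ! j) (vs ! l) (vs ! k)"
      unfolding contains_slash_def cross_def by blast
    moreover from this have "D (vs ! i) (vs ! j)"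
      using vs(3) D_total sorted_wrt_nth_less unfolding incomp_def by fastforce
    ultimately have "D (vs ! l) (vs ! k)" using D_cross by blast
    then show False using vs(3) kl sorted_wrt_nth_less by fastforce
  qed
  then show ?thesis using vs unfolding strong_cocomparability_def by blast
qed

end

section \<open>Weak edge-asteroids\<close>

context refl_graph
begin

section \<open>Avoidance as a forcing step\<close>

text \<open>Inducing \<open>2K_2\<close>, \<open>P_4\<close> or \<open>C_4\<close> means that the
  edges between the two pairs lie in one of the two perfect matchings. Loops make this uniform
  formula cover the degenerate cases and rule out shared vertices.\<close>

lemma avoids_iff:
  assumes "E u u'" "E v v'"
  shows "avoids E (u, u') (v, v') \<longleftrightarrow> \<not> E u v' \<and> \<not> E u' v \<or> \<not> E u v \<and> \<not> E u' v'"
proof -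
  have loops: "E u u" "E u' u'" "E v v" "E v' v'" using assms E_in_V E_refl by blast+
  have disj: "{u, u'} \<inter> {v, v'} = {}" if "\<not> E u v' \<and> \<not> E u' v \<or> \<not> E u v \<and> \<not> E u' v'"
    using that loops assms E_sym by auto
  show ?thesis
  proof (cases "{u, u'} \<inter> {v, v'} = {} \<and> u \<noteq> u' \<and> v \<noteq> v'")
    case True
    define C where "C = {p \<in> {(u, v), (u, v'), (u', v), (u', v')}. E (fst p) (snd p)}"
    have C_sub: "C \<subseteq> {(u, v), (u, v'), (u', v), (u', v')}" unfolding C_def by blast
    have doubleton: "C \<subseteq> {e, f} \<longleftrightarrow> C = {} \<or> C = {e} \<or> C = {f} \<or> C = {e, f}" for e f
      by blast
    have "avoids E (u, u') (v, v') \<longleftrightarrow>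
        C = {} \<or> card C = 1 \<or> C = {(u, v), (u', v')} \<or> C = {(u, v'), (u', v)}"
      unfolding avoids_def prod.case Let_def C_def[symmetric] using True by argo
    also have "C = {} \<or> card C = 1 \<or> C = {(u, v), (u', v')} \<or> C = {(u, v'), (u', v)}
        \<longleftrightarrow> C \<subseteq> {(u, v), (u', v')} \<or> C \<subseteq> {(u, v'), (u', v)}" (is "?L \<longleftrightarrow> ?R")
    proof
      assume ?L
      moreover have ?R if one: "card C = 1"
      proof -
        obtain e where "C = {e}" using one by (rule card_1_singletonE)
        then show ?thesis using C_sub by blast
      qed
      ultimately show ?R by blast
    next
      assume ?R
      then show ?L unfolding doubleton by auto
    qed
    also have "\<dots> \<longleftrightarrow> \<not> E u v' \<and> \<not> E u' v \<or> \<not> E u v \<and> \<not> E u' v'"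
    proof -
      have "C \<subseteq> X \<longleftrightarrow>
          (\<forall>p\<in>{(u, v), (u, v'), (u', v), (u', v')}. E (fst p) (snd p) \<longrightarrow> p \<in> X)" for X
        unfolding C_def by blast
      then have "C \<subseteq> {(u, v), (u', v')} \<longleftrightarrow> \<not> E u v' \<and> \<not> E u' v"
        "C \<subseteq> {(u, v'), (u', v)} \<longleftrightarrow> \<not> E u v \<and> \<not> E u' v'"
        using True by auto
      then show ?thesis by blast
    qed
    finally show ?thesis .
  next
    case False
    show ?thesis
    proof (cases "{u, u'} \<inter> {v, v'} = {}")
      case True
      then have "u = u' \<or> v = v'" using False by blast
      then show ?thesis unfolding avoids_def prod.case using True by (elim disjE) auto
    next
      case False
      then show ?thesis using disj unfolding avoids_def prod.case by blast
    qed
  qed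
qed

lemma avoids_cross:
  assumes "E u u'" "E v v'"
  shows "avoids E (u, u') (v, v') \<longleftrightarrow> cross u v u' v' \<or> cross u v' u' v"
  unfolding avoids_iff[OF assms] cross_def
  using assms E_commute[of v u'] E_commute[of v' u'] E_commute[of v v'] by blast

section \<open>From a reversing chain to an asteroid\<close>

lemma linked_sequence:
  assumes "linked par a b c d"
  shows "\<exists>m s t. s 0 = a \<and> t 0 = b \<and> s m = c \<and> t m = d
    \<and> (\<forall>i<m. cross (s i) (t i) (s (Suc i)) (t (Suc i)))"
  using assms
proof (induction rule: linked.induct)
  case (refl a b)
  show ?case by (intro exI[of _ 0] exI[of _ "\<lambda>_. a"] exI[of _ "\<lambda>_. b"]) simp
next
  case (step par a b c d e f)
  then obtain m s t where st: "s 0 = a" "t 0 = b" "s m = c" "t m = d"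
    "\<forall>i<m. cross (s i) (t i) (s (Suc i)) (t (Suc i))" by blast
  then show ?case using step.hyps(2)
    by (intro exI[of _ "Suc m"] exI[of _ "s(Suc m := e)"] exI[of _ "t(Suc m := f)"])
      (simp add: less_Suc_eq)
qed

text \<open>A chain from \<open>(a, b)\<close> to \<open>(b, a)\<close> closes up to a cyclic walk of length \<open>2 * m\<close> in which each
edge avoids the antipodal one and its two neighbours. Listing only \<open>2 * m - 1\<close> of the edges
gives the odd period that an asteroid needs.\<close>

lemma inversion_closed_walk:
  assumes "incomp a b" "equi a b b a"
  shows "\<exists>(m :: nat) (c :: nat \<Rightarrow> 'a). 2 \<le> m \<and> (\<forall>i. c (i + m + m) = c i) \<and> (\<forall>i. E (c i) (c (i + 1)))
    \<and> (\<forall>i. \<not> E (c i) (c (i + m + 1)))"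
proof -
  obtain m s t where st: "s 0 = a" "t 0 = b" "s m = b" "t m = a"
    and cr: "\<And>i. i < m \<Longrightarrow> cross (s i) (t i) (s (Suc i)) (t (Suc i))"
    using linked_sequence assms(2) unfolding equi_def by metis
  have V: "a \<in> V" "b \<in> V" using assms(1) incomp_in_V by blast+
  have "a \<noteq> b" using assms(1) unfolding incomp_def cross_def by blast
  then have "m \<noteq> 0" using st by metis
  \<comment> \<open>The walk runs through \<open>s\<close> and then \<open>t\<close>; the halves
    join because \<open>s m = t 0\<close> and \<open>t m = s 0\<close>.\<close>
  define c where "c i = (if i mod (2 * m) < m then s (i mod (2 * m)) else t (i mod (2 * m) - m))"
    for i
  have c_s: "c j = s j" if "j \<le> m" for j
    using that \<open>m \<noteq> 0\<close> st unfolding c_def by (cases "j = m") auto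
  have c_t: "c (j + m) = t j" if "j \<le> m" for j
    using that \<open>m \<noteq> 0\<close> st unfolding c_def by (cases "j = m") (auto simp: mult_2)
  have shift: "c (i + j) = c (i mod (2 * m) + j)" for i j
    unfolding c_def by (simp add: mod_add_left_eq)
  have period: "c (i + m + m) = c i" for i
    unfolding c_def by (simp add: add.assoc flip: mult_2)
  have "E (c i) (c (i + 1)) \<and> \<not> E (c i) (c (i + (m + 1)))" for i
  proof (cases "i mod (2 * m) < m")
    case True
    define j where "j = i mod (2 * m)"
    have "c i = s j" using c_s[of j] shift[of i 0] True unfolding j_def by simp
    moreover have "c (i + 1) = s (Suc j)"
      using c_s[of "Suc j"] shift[of i 1] True unfolding j_def by simp
    moreover have "c (i + (m + 1)) = t (Suc j)"
      using c_t[of "Suc j"] shift[of i "m + 1"] True unfolding j_def by (simp add: ac_simps)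
    ultimately show ?thesis using cr[of j] True unfolding j_def cross_def by simp
  next
    case False
    define j where "j = i mod (2 * m) - m"
    have "i mod (2 * m) < 2 * m" using \<open>m \<noteq> 0\<close> by simp
    then have j: "j < m" "i mod (2 * m) = j + m" using False unfolding j_def by auto
    have "c i = t j" using c_t[of j] shift[of i 0] j by simp
    moreover have "c (i + 1) = t (Suc j)"
      using c_t[of "Suc j"] shift[of i 1] j by simp
    moreover have "c (i + (m + 1)) = s (Suc j)"
      using c_s[of "Suc j"] shift[of i "m + 1"] period[of "Suc j"] j by (simp add: ac_simps)
    ultimately show ?thesis using cr[of j] j E_commute unfolding cross_def by simp
  qed
  moreover have "m \<noteq> 1"
  proof
    assume "m = 1"
    then have "cross a b b a" using cr[of 0] st by simp
    then show False using V E_refl unfolding cross_def by blast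
  qed
  ultimately show ?thesis
    using period \<open>m \<noteq> 0\<close> by (intro exI[of _ m] exI[of _ c]) (simp add: add.assoc)
qed

lemma inversion_asteroid:
  assumes "incomp a b" "equi a b b a"
  shows "has_weak_edge_asteroid E"
proof -
 obtain m :: nat and c :: "nat \<Rightarrow> 'a" where m: "2 \<le> m" and period: "\<And>i. c (i + m + m) = c i"
    and edge: "\<And>i. E (c i) (c (i + 1))" and far: "\<And>i. \<not> E (c i) (c (i + m + 1))"
    using inversion_closed_walk[OF assms] by auto
  \<comment> \<open>The period \<open>2 * k + 1\<close> is one less than the length
    \<open>2 * m\<close> of the closed walk: the edge starting at \<open>c (2 * k + 1)\<close> is
    omitted.\<close>
  define k where "k = m - 1"
  have m_k: "m = k + 1" "1 \<le> k" using m unfolding k_def by auto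
  have far': "\<not> E (c (i + 1)) (c (i + m))" for i
    using far[of "i + m"] period[of "i + 1"] E_commute by (simp add: ac_simps)
  have far'': "\<not> E (c i) (c (i + k))" for i
    using far[of "i + k"] period[of i] E_commute m_k by (simp add: ac_simps)
  have avoids_edge: "avoids E (c i, c (i + 1)) (c j, c (j + 1))"
    if "j = i + k \<or> j = i + m \<or> j = i + m + 1" for i j
    using that far[of i] far[of "i + 1"] far'[of i] far''[of i] m_k
    unfolding avoids_iff[OF edge edge] by (auto simp: ac_simps)
  have "\<exists>w. is_walk E w
      \<and> {w!0, w!1} = {c ((i + k) mod (2*k+1)), c ((i + k) mod (2*k+1) + 1)}
      \<and> {w!(length w - 2), w!(length w - 1)}
          = {c ((i + k + 1) mod (2*k+1)), c ((i + k + 1) mod (2*k+1) + 1)}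
      \<and> avoids_walk E (c i, c (i + 1)) w" if i: "i \<le> 2 * k" for i
  proof -
    consider "i < k" | "i = k" | "k < i" by linarith
    then show ?thesis
    proof cases
      case 1
      let ?w = "[c (i + k), c (i + k + 1), c (i + k + 2)]"
      have "is_walk E ?w" "avoids_walk E (c i, c (i + 1)) ?w"
        using edge[of "i + k"] edge[of "i + k + 1"]
          avoids_edge[of "i + k" i] avoids_edge[of "i + k + 1" i] m_k
        unfolding is_walk_def avoids_walk_def by (auto simp: less_Suc_eq)
      then show ?thesis using 1 by (intro exI[of _ ?w]) simp
    next
      \<comment> \<open>Here the index wraps from \<open>2 * k\<close> to \<open>0\<close>, so the
        walk has to pass over the omitted edge and takes three edges instead of two.\<close>
      case 2
      let ?w = "[c (i + k), c (i + k + 1), c (i + k + 2), c (i + k + 3)]"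
      have "is_walk E ?w" "avoids_walk E (c i, c (i + 1)) ?w"
        using edge[of "i + k"] edge[of "i + k + 1"] edge[of "i + k + 2"]
          avoids_edge[of "i + k" i] avoids_edge[of "i + k + 1" i] avoids_edge[of "i + k + 2" i] m_k
        unfolding is_walk_def avoids_walk_def by (auto simp: less_Suc_eq numeral_3_eq_3)
      then show ?thesis
        using 2 period[of 0] period[of 1] m_k
        by (intro exI[of _ ?w]) (simp add: mult_2 numeral_3_eq_3)
    next
      \<comment> \<open>Past the wrap the required edges start at \<open>c p\<close> and
        \<open>c (p + 1)\<close>: the antipode of edge \<open>i\<close> and its successor.\<close>
      case 3
      define p where "p = i - (k + 1)"
      have p: "i = p + m" using 3 m_k unfolding p_def by simp
      let ?w = "[c p, c (p + 1), c (p + 2)]"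
      have eq: "i + k = p + (2 * k + 1)" "i + k + 1 = p + 1 + (2 * k + 1)" and "p < 2 * k"
        using p m_k i by auto
      have "(i + k) mod (2 * k + 1) = p"
        unfolding eq(1) mod_add_self2 using \<open>p < 2 * k\<close> by simp
      moreover have "(i + k + 1) mod (2 * k + 1) = p + 1"
        unfolding eq(2) mod_add_self2 using \<open>p < 2 * k\<close> by simp
      moreover have "is_walk E ?w" "avoids_walk E (c i, c (i + 1)) ?w"
        using edge[of p] edge[of "p + 1"] avoids_edge[of "i + m" i] avoids_edge[of "i + m + 1" i]
          period[of p] period[of "p + 1"] period[of "p + 2"] p
        unfolding is_walk_def avoids_walk_def by (auto simp: less_Suc_eq ac_simps)
      ultimately show ?thesis by (intro exI[of _ ?w]) simp
    qed
  qed
  then have "weak_edge_asteroid E k c (\<lambda>i. c (i + 1))"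
    using m_k edge unfolding weak_edge_asteroid_def by simp
  then show ?thesis unfolding has_weak_edge_asteroid_def by blast
qed

end

section \<open>Slash-free orderings exclude asteroids\<close>

locale slash_free_order = refl_graph +
  fixes pos :: "'a \<Rightarrow> nat"
  assumes pos_inj: "inj_on pos V"
    and pos_cross: "cross a b c d \<Longrightarrow> pos a < pos b \<Longrightarrow> pos c < pos d"
begin

definition lo :: "'a \<Rightarrow> 'a \<Rightarrow> nat" where
  "lo u v = min (pos u) (pos v)"

lemma cross_pos:
  assumes "cross a b c d"
  shows "pos a < pos b \<and> pos c < pos d \<or> pos b < pos a \<and> pos d < pos c"
proof -
  have "a \<in> V" "b \<in> V" "a \<noteq> b" using assms E_in_V unfolding cross_def by blast+
  then have "pos a \<noteq> pos b" using pos_inj by (meson inj_onD)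
  then show ?thesis using pos_cross assms cross_swap by (metis nat_neq_iff)
qed

lemma avoids_lo_neq:
  assumes "E u u'" "E v v'" "avoids E (u, u') (v, v')"
  shows "lo u u' \<noteq> lo v v'"
  using assms cross_pos[of u v u' v'] cross_pos[of u v' u' v] avoids_cross[OF assms(1,2)]
  unfolding lo_def by auto

lemma lo_commute: "lo u v = lo v u"
  unfolding lo_def by simp

text \<open>With \<open>a\<close> the left end of the avoiding edge, a step from right to left
  forces \<open>w\<close> before \<open>c\<close>. The avoidance conditions then leave
  \<open>w\<close> adjacent to neither \<open>a\<close> nor \<open>c\<close>, and the loop at
  \<open>w\<close> forces \<open>c\<close> before \<open>w\<close>.\<close>

lemma no_jump:
  assumes "E a c" "E w z" "cross a v c w \<or> cross a w c v" "cross a w c z \<or> cross a z c w"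
    and "pos a \<le> pos c"
  shows "\<not> (pos a < lo v w \<and> lo w z < pos a)"
proof
  assume "pos a < lo v w \<and> lo w z < pos a"
  then have less: "pos a < pos v" "pos a < pos w" "pos z < pos a"
    unfolding lo_def by auto
  have "\<not> cross a w c z" using pos_cross[of a w c z] less assms(5) by linarith
  then have z: "cross a z c w" using assms(4) by blast
  then have "pos w < pos c" using cross_pos[OF z] less by linarith
  moreover from this have "\<not> cross a v c w" using pos_cross[of a v c w] less by linarith
  then have "cross a w c v" using assms(3) by blast
  then have "cross a w c w" using z assms(2) E_in_V E_refl E_commute unfolding cross_def by metis
  then have "pos c < pos w" using pos_cross less by blast
  ultimately show False by linarith
qed

lemma lo_less_consecutive:
  assumes E: "E u u'" "E v w" "E w z"
    and av: "avoids E (u, u') (v, w)" "avoids E (u, u') (w, z)"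
  shows "lo u u' < lo v w \<longleftrightarrow> lo u u' < lo w z"
proof -
  obtain a c where ac: "{a, c} = {u, u'}" "pos a \<le> pos c"
    by (metis insert_commute nat_le_linear)
  have "E a c" using ac(1) E(1) E_sym by (metis doubleton_eq_iff)
  have lo: "lo u u' = pos a" using ac unfolding lo_def by (auto simp: doubleton_eq_iff)
  have cr: "cross a v c w \<or> cross a w c v" "cross a w c z \<or> cross a z c w"
    using av[unfolded avoids_cross[OF E(1,2)] avoids_cross[OF E(1,3)]] ac(1)
      E_commute unfolding cross_def doubleton_eq_iff by metis+
  have "lo u u' \<noteq> lo v w" "lo u u' \<noteq> lo w z"
    using avoids_lo_neq E av by blast+
  moreover have "\<not> (pos a < lo v w \<and> lo w z < pos a)"
    using no_jump[OF \<open>E a c\<close> E(3) cr ac(2)] .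
  \<comment> \<open>The opposite jump is excluded by reading the walk backwards.\<close>
  moreover have "\<not> (pos a < lo z w \<and> lo w v < pos a)"
    using no_jump[OF \<open>E a c\<close> _ _ _ ac(2), of w v z] cr E(2) E_sym by blast
  ultimately show ?thesis using lo lo_commute[of v w] lo_commute[of w z] by linarith
qed

lemma lo_less_walk:
  assumes "E u u'" "is_walk E w" "avoids_walk E (u, u') w" "j + 1 < length w"
  shows "lo u u' < lo (w ! j) (w ! (j + 1)) \<longleftrightarrow> lo u u' < lo (w ! 0) (w ! 1)"
  using assms(4)
proof (induction j)
  case 0
  then show ?case by simp
next
  case (Suc j)
  have "lo u u' < lo (w ! j) (w ! (j + 1)) \<longleftrightarrow> lo u u' < lo (w ! (j + 1)) (w ! (j + 1 + 1))"
    by (rule lo_less_consecutive) (use assms Suc.prems in \<open>auto simp: is_walk_def avoids_walk_def\<close>)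
  then show ?case using Suc by simp
qed

lemma no_weak_edge_asteroid: "\<not> has_weak_edge_asteroid E"
proof
  assume "has_weak_edge_asteroid E"
  then obtain k x y where ast: "weak_edge_asteroid E k x y"
    unfolding has_weak_edge_asteroid_def by blast
  define n where "n = 2 * k + 1"
  define L where "L i = lo (x i) (y i)" for i
  have main: "(L i < L ((i + k) mod n) \<longleftrightarrow> L i < L ((i + k + 1) mod n)) \<and> L i \<noteq> L ((i + k + 1) mod n)"
    if "i < n" for i
  proof -
    have i: "i \<le> 2 * k" using that unfolding n_def by simp
    define f where "f = (i + k) mod n"
    define l where "l = (i + k + 1) mod n"
    obtain w where w: "is_walk E w" "avoids_walk E (x i, y i) w"
      and first: "{w ! 0, w ! 1} = {x f, y f}"
      and last: "{w ! (length w - 2), w ! (length w - 1)} = {x l, y l}"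
      using ast i unfolding weak_edge_asteroid_def n_def f_def l_def by blast
    have E: "E (x i) (y i)" using ast i unfolding weak_edge_asteroid_def by blast
    define j where "j = length w - 2"
    have j: "j + 1 < length w" "length w - 1 = j + 1"
      using w(1) unfolding is_walk_def j_def by auto
    have "lo (w ! 0) (w ! 1) = L f"
      using first lo_commute unfolding L_def doubleton_eq_iff by metis
    moreover have "lo (w ! j) (w ! (j + 1)) = L l"
      using last lo_commute unfolding L_def doubleton_eq_iff j(2) j_def[symmetric] by metis
    moreover have "lo (x i) (y i) \<noteq> lo (w ! j) (w ! (j + 1))"
      by (rule avoids_lo_neq[OF E]) (use w j in \<open>auto simp: is_walk_def avoids_walk_def\<close>)
    ultimately show ?thesis
      using lo_less_walk[OF E w j(1)] unfolding f_def l_def L_def by simp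
  qed
  define s where "s i \<longleftrightarrow> L i < L ((i + k) mod n)" for i
  \<comment> \<open>Since \<open>(i + k + 1) + k\<close> is \<open>i\<close> modulo
    \<open>n\<close>, edges \<open>i\<close> and \<open>i + k + 1\<close> are compared from both
    ends, which negates \<open>s\<close>.\<close>
  have flip: "s ((i + k + 1) mod n) \<longleftrightarrow> \<not> s i" if "i < n" for i
  proof -
    have "((i + k + 1) mod n + k) mod n = (i + k + 1 + k) mod n"
      by (rule mod_add_left_eq)
    also have "i + k + 1 + k = i + n"
      unfolding n_def by simp
    finally have "((i + k + 1) mod n + k) mod n = (i + n) mod n" .
    then have "((i + k + 1) mod n + k) mod n = i" using that by simp
    then show ?thesis using main[OF that] unfolding s_def by auto
  qed
  have "s ((j * (k + 1)) mod n) \<longleftrightarrow> (s 0 \<longleftrightarrow> even j)" for j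
  proof (induction j)
    case 0
    then show ?case by simp
  next
    case (Suc j)
    have "(Suc j * (k + 1)) mod n = ((j * (k + 1)) mod n + (k + 1)) mod n"
      unfolding mod_add_left_eq by (simp add: ac_simps)
    moreover have "(j * (k + 1)) mod n < n" unfolding n_def by simp
    ultimately show ?case using Suc flip[of "(j * (k + 1)) mod n"] by (simp add: add.assoc)
  qed
  \<comment> \<open>After \<open>n\<close> jumps the index is \<open>0\<close> again, but
    \<open>s\<close> has been negated an odd number of times.\<close>
  from this[of n] have "odd n \<Longrightarrow> False" by simp
  then show False unfolding n_def by simp
qed

end

lemma (in refl_graph) strong_cocomparability_no_asteroid:
  assumes "strong_cocomparability V E"
  shows "\<not> has_weak_edge_asteroid E"
proof -
  obtain vs where vs: "distinct vs" "set vs = V" "\<not> contains_slash E vs"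
    using assms unfolding strong_cocomparability_def by blast
  define pos where "pos v = (SOME i. i < length vs \<and> vs ! i = v)" for v
  have pos: "pos v < length vs \<and> vs ! pos v = v" if "v \<in> V" for v
    using that vs(2) someI_ex[of "\<lambda>i. i < length vs \<and> vs ! i = v"]
    unfolding pos_def in_set_conv_nth by (metis in_set_conv_nth)
  have "slash_free_order V E pos"
  proof
    show "inj_on pos V" using pos by (metis inj_onI)
  next
    fix a b c d
    assume cr: "cross a b c d" and less: "pos a < pos b"
    then have V: "a \<in> V" "b \<in> V" "c \<in> V" "d \<in> V" unfolding cross_def using E_in_V by blast+
    have "\<not> pos d < pos c"
    proof
      assume "pos d < pos c"
      then have "contains_slash E vs"
        using cr less V[THEN pos] unfolding contains_slash_def cross_def
        by (intro exI[of _ "pos a"] exI[of _ "pos b"] exI[of _ "pos d"] exI[of _ "pos c"]) simp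
      then show False using vs(3) by blast
    qed
    moreover have "c \<noteq> d" using cr unfolding cross_def by blast
    then have "pos c \<noteq> pos d" using pos V by metis
    ultimately show "pos c < pos d" by linarith
  qed
  then interpret slash_free_order V E pos .
  show ?thesis by (rule no_weak_edge_asteroid)
qed

theorem theorem2:
  fixes V :: "'a set" and E :: "'a \<Rightarrow> 'a \<Rightarrow> bool"
  assumes "reflexive_graph V E"
  shows "strong_cocomparability V E \<longleftrightarrow> \<not> has_weak_edge_asteroid E"
proof -
  interpret refl_graph V E using assms by unfold_locales
  show ?thesis
  proof
    assume "strong_cocomparability V E"
    then show "\<not> has_weak_edge_asteroid E" by (rule strong_cocomparability_no_asteroid)
  next
    assume "\<not> has_weak_edge_asteroid E"
    then have "\<not> equi a b b a" if "incomp a b" for a b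
      using inversion_asteroid[OF that] by blast
    then show "strong_cocomparability V E" by (rule strong_cocomparability_if_no_inversion)
  qed
qed

end
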